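(* Let $d\ge1$ and $d+1\le r\le 2d$ be integers. There exist constants $C>0$ and $n_0$ (depending only on $d$ and $r$) such that for all integers $n\ge n_0$, $$\overleftarrow{m}(\mathbb{T}_n^d,r)\ \ge\ 2\Big(1-\frac{d}{r}\Big)n^d-Cn^{d-1}.$$
   Context: The $d$-dimensional torus $\mathbb{T}_n^d$ is the graph with vertex set $[n]^d=\{1,\dots,n\}^d$, where two vertices are adjacent iff they differ in exactly one coordinate $j$ and in that coordinate $x_j-x'_j\equiv\pm1\pmod n$. A configuration assigns each vertex a state active (1) or inactive (0); its size is the number of active vertices. Reversible $r$-bootstrap percolation: in each round, simultaneously, every vertex becomes active if it has at least $r$ active neighbors and inactive otherwise. A dynamo is an initial configuration such that from some time on all vertices are active forever. $\overleftarrow{m}(G,r)$ denotes the minimum size of a dynamo under reversible $r$-bootstrap percolation on $G$. *)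

theory Defs
  imports Complex_Main "HOL-Library.FuncSet" "HOL-Number_Theory.Cong"
begin

text \<open>A graph is given by its vertex set \<open>V\<close> and adjacency relation \<open>E\<close>;
  a configuration is represented by its set of active vertices.\<close>

definition rev_step :: "'a set \<Rightarrow> ('a \<Rightarrow> 'a \<Rightarrow> bool) \<Rightarrow> nat \<Rightarrow> 'a set \<Rightarrow> 'a set" where
  "rev_step V E r A = {v \<in> V. r \<le> card {u \<in> V. E v u \<and> u \<in> A}}"

definition rev_dynamo :: "'a set \<Rightarrow> ('a \<Rightarrow> 'a \<Rightarrow> bool) \<Rightarrow> nat \<Rightarrow> 'a set \<Rightarrow> bool" where
  "rev_dynamo V E r A \<longleftrightarrow> A \<subseteq> V \<and> (\<exists>T. \<forall>t\<ge>T. (rev_step V E r ^^ t) A = V)"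

text \<open>On the natural numbers \<open>Inf\<close> of a nonempty set is its minimum, while \<open>Inf {} = 0\<close>.
  Thus the following is the minimum size of a dynamo whenever one exists; on the torus with
  \<open>n \<ge> 3\<close> and \<open>r \<le> 2 * d\<close> the all-active configuration is one.\<close>

definition min_rev_dynamo :: "'a set \<Rightarrow> ('a \<Rightarrow> 'a \<Rightarrow> bool) \<Rightarrow> nat \<Rightarrow> nat" where
  "min_rev_dynamo V E r = Inf {card A | A. rev_dynamo V E r A}"

definition torus_verts :: "nat \<Rightarrow> nat \<Rightarrow> (nat \<Rightarrow> nat) set" where
  "torus_verts d n = {1..d} \<rightarrow>\<^sub>E {1..n}"

definition torus_adj :: "nat \<Rightarrow> nat \<Rightarrow> (nat \<Rightarrow> nat) \<Rightarrow> (nat \<Rightarrow> nat) \<Rightarrow> bool" where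
  "torus_adj d n x y \<longleftrightarrow>
     (\<exists>j. {i \<in> {1..d}. x i \<noteq> y i} = {j} \<and>
        ([int (x j) - int (y j) = 1] (mod int n) \<or> [int (x j) - int (y j) = - 1] (mod int n)))"

end

theory Submission
  imports Defs
begin

text \<open>The Goles--Olivos energy \<open>r|A| + r|B| - e(A, B)\<close> of two consecutive configurations is
  symmetric in \<open>A\<close> and \<open>B\<close>, and for fixed \<open>A\<close> it is minimised over \<open>B\<close> by the successor of \<open>A\<close>.
  Hence it never increases along the dynamics. Comparing with \<open>B\<close> empty, its initial value is at
  most \<open>r|A|\<close>, whereas once everything is active it is \<open>(2r - k)|V|\<close> on a \<open>k\<close>-regular graph.
  The torus is a Cartesian product of \<open>d\<close> cycles, hence \<open>2d\<close>-regular.\<close>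

definition degree_in :: "'a set \<Rightarrow> ('a \<Rightarrow> 'a \<Rightarrow> bool) \<Rightarrow> 'a \<Rightarrow> nat" where
  "degree_in A E v = card {u \<in> A. E v u}"

lemma sum_degree_in_commute:
  assumes "finite A" "finite B" "symp E"
  shows "(\<Sum>v\<in>B. degree_in A E v) = (\<Sum>u\<in>A. degree_in B E u)"
proof -
  have "{v \<in> B. E v u} = {v \<in> B. E u v}" for u
    using assms(3) by (blast dest: sympD)
  then show ?thesis
    unfolding degree_in_def using assms(1,2) by (intro sum_multicount_gen) simp_all
qed

lemma rev_step_subset: "rev_step V E r A \<subseteq> V"
  by (auto simp: rev_step_def)

lemma rev_step_funpow_subset:
  assumes "A \<subseteq> V"
  shows "(rev_step V E r ^^ t) A \<subseteq> V"
  using assms by (cases t) (simp_all add: rev_step_subset)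

lemma rev_step_eq_degree_in:
  assumes "A \<subseteq> V"
  shows "rev_step V E r A = {v \<in> V. r \<le> degree_in A E v}"
proof -
  have "{u \<in> V. E v u \<and> u \<in> A} = {u \<in> A. E v u}" for v
    using assms by auto
  then show ?thesis
    by (simp add: rev_step_def degree_in_def)
qed

definition energy :: "('a \<Rightarrow> 'a \<Rightarrow> bool) \<Rightarrow> nat \<Rightarrow> 'a set \<Rightarrow> 'a set \<Rightarrow> int" where
  "energy E r A B = int r * (int (card A) + int (card B)) - (\<Sum>v\<in>B. int (degree_in A E v))"

lemma energy_commute:
  assumes "finite A" "finite B" "symp E"
  shows "energy E r A B = energy E r B A"
  using sum_degree_in_commute[OF assms]
  by (simp add: energy_def add.commute[of "int (card A)"] flip: of_nat_sum)

lemma energy_eq_sum: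
  "energy E r A B = int r * int (card A) + (\<Sum>v\<in>B. int r - int (degree_in A E v))"
  by (simp add: energy_def sum_subtractf algebra_simps)

lemma sum_nonpos_filter_le:
  fixes f :: "'a \<Rightarrow> 'b :: {linorder, ordered_comm_monoid_add}"
  assumes "finite V" "B \<subseteq> V"
  shows "sum f {v \<in> V. f v \<le> 0} \<le> sum f B"
proof -
  have "sum f {v \<in> V. f v \<le> 0} = (\<Sum>v\<in>V. if f v \<le> 0 then f v else 0)"
    using assms(1) by (rule sum.inter_filter)
  also have "\<dots> \<le> (\<Sum>v\<in>V. if v \<in> B then f v else 0)"
    by (rule sum_mono) auto
  also have "\<dots> = sum f B"
    using assms by (simp add: Int_absorb1 flip: sum.inter_restrict)
  finally show ?thesis .
qed

lemma energy_rev_step_le: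
  assumes "finite V" "A \<subseteq> V" "B \<subseteq> V"
  shows "energy E r A (rev_step V E r A) \<le> energy E r A B"
  using sum_nonpos_filter_le[OF assms(1,3), of "\<lambda>v. int r - int (degree_in A E v)"]
  by (simp add: energy_eq_sum rev_step_eq_degree_in[OF assms(2)])

lemma decseq_energy:
  assumes "finite V" "symp E" "A \<subseteq> V"
  shows "decseq (\<lambda>t. energy E r ((rev_step V E r ^^ t) A) ((rev_step V E r ^^ Suc t) A))"
proof (rule decseq_SucI)
  fix t
  let ?A = "\<lambda>t. (rev_step V E r ^^ t) A"
  have sub: "?A s \<subseteq> V" for s
    using assms(3) by (rule rev_step_funpow_subset)
  have "energy E r (?A (Suc t)) (?A (Suc (Suc t))) \<le> energy E r (?A (Suc t)) (?A t)"
    using energy_rev_step_le[OF assms(1) sub sub, of E r "Suc t" t] by simp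
  also have "\<dots> = energy E r (?A t) (?A (Suc t))"
    using assms(1,2) sub by (blast intro: energy_commute finite_subset)
  finally show "energy E r (?A (Suc t)) (?A (Suc (Suc t))) \<le> energy E r (?A t) (?A (Suc t))" .
qed

lemma rev_dynamo_card_ge:
  assumes "finite V" "symp E" "rev_dynamo V E r A"
  shows "2 * r * card V \<le> r * card A + (\<Sum>v\<in>V. degree_in V E v)"
proof -
  let ?A = "\<lambda>t. (rev_step V E r ^^ t) A"
  obtain T where "A \<subseteq> V" and T: "\<And>t. t \<ge> T \<Longrightarrow> ?A t = V"
    using assms(3) by (auto simp: rev_dynamo_def)
  have "energy E r V V = energy E r (?A T) (?A (Suc T))"
    using T[of T] T[of "Suc T"] by simp
  also have "\<dots> \<le> energy E r (?A 0) (?A (Suc 0))"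
    using decseq_energy[OF assms(1,2) \<open>A \<subseteq> V\<close>] by (rule decseqD) simp
  also have "\<dots> \<le> energy E r A {}"
    using energy_rev_step_le[OF assms(1) \<open>A \<subseteq> V\<close> empty_subsetI] by simp
  finally have "int (2 * r * card V) \<le> int (r * card A + (\<Sum>v\<in>V. degree_in V E v))"
    by (simp add: energy_def algebra_simps)
  then show ?thesis
    by (simp only: of_nat_le_iff)
qed

lemma rev_dynamo_all_active:
  assumes "\<And>v. v \<in> V \<Longrightarrow> r \<le> degree_in V E v"
  shows "rev_dynamo V E r V"
proof -
  have "rev_step V E r V = V"
    using assms by (auto simp: rev_step_eq_degree_in)
  then have "(rev_step V E r ^^ t) V = V" for t
    by (induction t) simp_all
  then show ?thesis
    by (simp add: rev_dynamo_def)
qed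

lemma min_rev_dynamo_attained:
  assumes "rev_dynamo V E r B"
  obtains A where "rev_dynamo V E r A" "min_rev_dynamo V E r = card A"
proof -
  have "min_rev_dynamo V E r \<in> {card A | A. rev_dynamo V E r A}"
    unfolding min_rev_dynamo_def using assms by (intro Inf_nat_def1) auto
  then show ?thesis
    using that by auto
qed

lemma min_rev_dynamo_regular_ge:
  assumes "finite V" "symp E" and regular: "\<And>v. v \<in> V \<Longrightarrow> degree_in V E v = k"
    and "0 < r" "r \<le> k"
  shows "real (min_rev_dynamo V E r) \<ge> (2 - real k / real r) * real (card V)"
proof -
  have "rev_dynamo V E r V"
    using regular \<open>r \<le> k\<close> by (intro rev_dynamo_all_active) simp
  then obtain A where A: "rev_dynamo V E r A" and card_A: "min_rev_dynamo V E r = card A"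
    by (rule min_rev_dynamo_attained)
  have "2 * r * card V \<le> r * card A + k * card V"
    using rev_dynamo_card_ge[OF assms(1,2) A] regular by (simp add: mult.commute)
  then have "real (2 * r * card V) \<le> real (r * card A + k * card V)"
    by (simp only: of_nat_le_iff)
  then show ?thesis
    using \<open>0 < r\<close> by (simp add: card_A field_simps)
qed

definition box_adj :: "'i set \<Rightarrow> ('i \<Rightarrow> 'a \<Rightarrow> 'a \<Rightarrow> bool) \<Rightarrow> ('i \<Rightarrow> 'a) \<Rightarrow> ('i \<Rightarrow> 'a) \<Rightarrow> bool" where
  "box_adj I R x y \<longleftrightarrow> (\<exists>j. {i \<in> I. x i \<noteq> y i} = {j} \<and> R j (x j) (y j))"

lemma symp_box_adj:
  assumes "\<And>i. i \<in> I \<Longrightarrow> symp (R i)"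
  shows "symp (box_adj I R)"
proof (rule sympI)
  fix x y assume "box_adj I R x y"
  then obtain j where j: "{i \<in> I. x i \<noteq> y i} = {j}" "R j (x j) (y j)"
    by (auto simp: box_adj_def)
  have "{i \<in> I. y i \<noteq> x i} = {j}"
    unfolding j(1)[symmetric] by (rule Collect_cong) metis
  moreover have "R j (y j) (x j)"
    using j assms by (blast dest: sympD)
  ultimately show "box_adj I R y x"
    unfolding box_adj_def by blast
qed

lemma PiE_fun_upd_same:
  assumes "x \<in> Pi\<^sub>E I S" "j \<in> I" "b \<in> S j"
  shows "x(j := b) \<in> Pi\<^sub>E I S"
  using PiE_fun_upd[OF assms(3,1)] assms(2) by (simp add: insert_absorb)

lemma box_adj_neighbours_eq_image:
  assumes "x \<in> Pi\<^sub>E I S" and "\<And>i. i \<in> I \<Longrightarrow> irreflp (R i)"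
  shows "{y \<in> Pi\<^sub>E I S. box_adj I R x y} =
    (\<lambda>(j, b). x(j := b)) ` (SIGMA j:I. {b \<in> S j. R j (x j) b})"
proof (intro subset_antisym subsetI)
  fix y assume "y \<in> {y \<in> Pi\<^sub>E I S. box_adj I R x y}"
  then obtain j where y: "y \<in> Pi\<^sub>E I S" and j: "{i \<in> I. x i \<noteq> y i} = {j}" "R j (x j) (y j)"
    by (auto simp: box_adj_def)
  have "j \<in> I" and agree: "\<And>i. \<lbrakk>i \<in> I; i \<noteq> j\<rbrakk> \<Longrightarrow> x i = y i"
    using j(1) by blast+
  then have "y j \<in> S j"
    using y by blast
  have y_eq: "y = x(j := y j)"
  proof (rule PiE_ext[OF y])
    show "x(j := y j) \<in> Pi\<^sub>E I S"
      using assms(1) \<open>j \<in> I\<close> \<open>y j \<in> S j\<close> by (rule PiE_fun_upd_same)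
    show "y i = (x(j := y j)) i" if "i \<in> I" for i
      using agree[OF that] by simp
  qed
  have "(j, y j) \<in> (SIGMA j:I. {b \<in> S j. R j (x j) b})"
    using \<open>j \<in> I\<close> \<open>y j \<in> S j\<close> j(2) by simp
  then show "y \<in> (\<lambda>(j, b). x(j := b)) ` (SIGMA j:I. {b \<in> S j. R j (x j) b})"
    by (rule rev_image_eqI) (simp flip: y_eq)
next
  fix y assume "y \<in> (\<lambda>(j, b). x(j := b)) ` (SIGMA j:I. {b \<in> S j. R j (x j) b})"
  then obtain j b where j: "j \<in> I" and b: "b \<in> S j" "R j (x j) b" and y: "y = x(j := b)"
    by auto
  have "y \<in> Pi\<^sub>E I S"
    unfolding y using assms(1) j b(1) by (rule PiE_fun_upd_same)
  moreover have "x j \<noteq> b"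
    using assms(2)[OF j] b(2) by (auto dest: irreflpD)
  then have "{i \<in> I. x i \<noteq> y i} = {j}"
    using j y by auto
  ultimately show "y \<in> {y \<in> Pi\<^sub>E I S. box_adj I R x y}"
    using b(2) y by (auto simp: box_adj_def)
qed

lemma degree_in_box_adj:
  assumes "finite I" "x \<in> Pi\<^sub>E I S"
    and "\<And>i. i \<in> I \<Longrightarrow> finite (S i)" and irrefl: "\<And>i. i \<in> I \<Longrightarrow> irreflp (R i)"
  shows "degree_in (Pi\<^sub>E I S) (box_adj I R) x = (\<Sum>i\<in>I. degree_in (S i) (R i) (x i))"
proof -
  let ?N = "SIGMA j:I. {b \<in> S j. R j (x j) b}"
  have "inj_on (\<lambda>(j, b). x(j := b)) ?N"
  proof (rule inj_onI, clarify)
    fix j b k c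
    assume "j \<in> I" "R j (x j) b" and eq: "x(j := b) = x(k := c)"
    then have "b \<noteq> x j"
      using irrefl by (auto dest: irreflpD)
    then show "j = k \<and> b = c"
      using fun_cong[OF eq, of j] by (auto split: if_splits)
  qed
  then have "degree_in (Pi\<^sub>E I S) (box_adj I R) x = card ?N"
    by (simp add: degree_in_def box_adj_neighbours_eq_image[OF assms(2) irrefl] card_image)
  also have "\<dots> = (\<Sum>i\<in>I. degree_in (S i) (R i) (x i))"
    using assms(1,3) by (simp add: degree_in_def)
  finally show ?thesis .
qed

definition cycle_adj :: "nat \<Rightarrow> nat \<Rightarrow> nat \<Rightarrow> bool" where
  "cycle_adj n a b \<longleftrightarrow>
     [int a - int b = 1] (mod int n) \<or> [int a - int b = - 1] (mod int n)"

lemma symp_cycle_adj: "symp (cycle_adj n)"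
proof (rule sympI)
  fix a b assume "cycle_adj n a b"
  then show "cycle_adj n b a"
    using cong_minus_minus_iff[of "int a - int b" 1 "int n"]
      cong_minus_minus_iff[of "int a - int b" "- 1" "int n"]
    by (auto simp: cycle_adj_def)
qed

lemma irreflp_cycle_adj:
  assumes "2 \<le> n"
  shows "irreflp (cycle_adj n)"
  using assms by (auto intro!: irreflpI simp: cycle_adj_def cong_iff_dvd_diff)

lemma card_cong_atLeastAtMost:
  assumes "0 < n"
  shows "card {b \<in> {1..n}. [int b = c] (mod int n)} = 1"
proof -
  let ?b = "Suc (nat ((c - 1) mod int n))"
  have "b = ?b" if b: "b \<in> {1..n}" "[int b = c] (mod int n)" for b
  proof -
    have "(int b - 1) mod int n = (c - 1) mod int n"
      using cong_diff[OF b(2) cong_refl[of 1]] by (simp add: cong_def)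
    then show ?thesis
      using b(1) by auto
  qed
  moreover have "?b \<in> {1..n}" "[int ?b = c] (mod int n)"
    using assms by (auto simp: cong_def Suc_le_eq nat_less_iff mod_simps)
  ultimately have "{b \<in> {1..n}. [int b = c] (mod int n)} = {?b}"
    by blast
  then show ?thesis
    by simp
qed

lemma degree_in_cycle:
  assumes "3 \<le> n"
  shows "degree_in {1..n} (cycle_adj n) a = 2"
proof -
  let ?class = "\<lambda>c. {b \<in> {1..n}. [int b = c] (mod int n)}"
  have "[int a - int b = c] (mod int n) \<longleftrightarrow> [int b = int a - c] (mod int n)" for b c
    using dvd_diff_commute[of "int n" "int b" "int a - c"]
    by (simp add: cong_iff_dvd_diff algebra_simps)
  then have "{b \<in> {1..n}. cycle_adj n a b} = ?class (int a - 1) \<union> ?class (int a + 1)"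
    by (auto simp: cycle_adj_def)
  moreover have "?class (int a - 1) \<inter> ?class (int a + 1) = {}"
  proof -
    have "\<not> [int a - 1 = int a + 1] (mod int n)"
      using assms by (auto simp: cong_iff_dvd_diff dest: zdvd_imp_le)
    then show ?thesis
      by (auto dest: cong_sym cong_trans)
  qed
  ultimately have "degree_in {1..n} (cycle_adj n) a
      = card (?class (int a - 1)) + card (?class (int a + 1))"
    by (simp add: degree_in_def card_Un_disjoint)
  also have "\<dots> = 2"
    using assms card_cong_atLeastAtMost[of n] by simp
  finally show ?thesis .
qed

lemma torus_adj_eq_box_adj: "torus_adj d n = box_adj {1..d} (\<lambda>_. cycle_adj n)"
  by (simp add: fun_eq_iff torus_adj_def box_adj_def cycle_adj_def)

lemma symp_torus_adj: "symp (torus_adj d n)"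
  by (simp add: torus_adj_eq_box_adj symp_box_adj symp_cycle_adj)

lemma degree_in_torus:
  assumes "3 \<le> n" "x \<in> torus_verts d n"
  shows "degree_in (torus_verts d n) (torus_adj d n) x = 2 * d"
  using assms degree_in_cycle[OF assms(1)]
  by (simp add: torus_verts_def torus_adj_eq_box_adj degree_in_box_adj irreflp_cycle_adj)

lemma min_rev_dynamo_torus_ge:
  assumes "3 \<le> n" "0 < r" "r \<le> 2 * d"
  shows "real (min_rev_dynamo (torus_verts d n) (torus_adj d n) r)
    \<ge> 2 * (1 - real d / real r) * real n ^ d"
proof -
  have "finite (torus_verts d n)" and "card (torus_verts d n) = n ^ d"
    by (simp_all add: torus_verts_def finite_PiE card_PiE)
  then show ?thesis
    using min_rev_dynamo_regular_ge[OF _ symp_torus_adj degree_in_torus[OF assms(1)] assms(2,3)]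
    by (simp add: algebra_simps)
qed

theorem theorem2:
  fixes d r :: nat
  assumes "1 \<le> d" and "d + 1 \<le> r" and "r \<le> 2 * d"
  shows "\<exists>(C::real) (n0::nat). C > 0 \<and>
    (\<forall>n\<ge>n0. real (min_rev_dynamo (torus_verts d n) (torus_adj d n) r)
        \<ge> 2 * (1 - real d / real r) * real n ^ d - C * real n ^ (d - 1))"
proof (rule exI[of _ 1], rule exI[of _ 3], intro conjI allI impI)
  fix n :: nat assume "3 \<le> n"
  then have "2 * (1 - real d / real r) * real n ^ d
      \<le> real (min_rev_dynamo (torus_verts d n) (torus_adj d n) r)"
    using assms by (intro min_rev_dynamo_torus_ge) auto
  then show "2 * (1 - real d / real r) * real n ^ d - 1 * real n ^ (d - 1)
      \<le> real (min_rev_dynamo (torus_verts d n) (torus_adj d n) r)"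
    by (rule order_trans[rotated]) simp
qed simp

end
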